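(* Let $n$ be a positive integer. Each non-meager set $E\subset\mathbb{R}^n$ with the Baire property satisfies $\dim_U E=n$, and no dense subset of $\mathbb{R}^n$ can be covered by a $G_\delta$ set $G\subset\mathbb{R}^n$ with $\dim_U G=0$.
   Context: A set is meager if it is a countable union of nowhere dense sets; a set has the Baire property if its symmetric difference with some open set is meager. $|E|$ denotes the diameter of a set $E$. $\mathcal{D}$ is the family of all sets $D\subset(0,\infty)$ with $\inf D=0$ that are open in the Sorgenfrey topology (generated by the intervals $[a,b)$), i.e. for every $t\in D$ there is $\delta>0$ with $[t,t+\delta)\subset D$. For $D\in\mathcal{D}$, $E\subset\mathbb{R}^n$ and $s\ge0$ let $$\mathcal{H}^s_{D,\infty}(E)=\inf\left\{\sum_{i=1}^\infty|E_i|^s: E\subset\bigcup_{i=1}^\infty E_i,\ |E_i|\in D\text{ for all }i\right\},\qquad \dim_H^D E=\inf\{s\ge0:\mathcal{H}^s_{D,\infty}(E)=0\}.$$ The universal restricted Hausdorff dimension is $\dim_U E=\sup\{\dim_H^D E: D\in\mathcal{D}\}$. *)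

theory Defs
  imports "HOL-Analysis.Analysis"
begin

section \<open>Meager sets and the Baire property\<close>

definition nowhere_dense :: "'a::topological_space set \<Rightarrow> bool" where
  "nowhere_dense A \<longleftrightarrow> interior (closure A) = {}"

definition meager :: "'a::topological_space set \<Rightarrow> bool" where
  "meager A \<longleftrightarrow> (\<exists>N :: nat \<Rightarrow> 'a set. (\<forall>i. nowhere_dense (N i)) \<and> A = (\<Union>i. N i))"

definition baire_property :: "'a::topological_space set \<Rightarrow> bool" where
  "baire_property A \<longleftrightarrow> (\<exists>U. open U \<and> meager ((A - U) \<union> (U - A)))"


section \<open>Admissible sets of diameters\<close>

definition sorgenfrey_topology :: "real topology" where
  "sorgenfrey_topology = topology_generated_by {{a..<b} | a b. True}"

lemma openin_sorgenfrey_topology_iff: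
  "openin sorgenfrey_topology D \<longleftrightarrow> (\<forall>t\<in>D. \<exists>\<delta>>0. {t..<t + \<delta>} \<subseteq> D)"
proof
  assume "openin sorgenfrey_topology D"
  then have "generate_topology_on {{a..<b} | a b :: real. True} D"
    by (simp add: sorgenfrey_topology_def openin_topology_generated_by_iff)
  then show "\<forall>t\<in>D. \<exists>\<delta>>0. {t..<t + \<delta>} \<subseteq> D"
  proof induction
    case Empty
    then show ?case by simp
  next
    case (Int A B)
    show ?case
    proof
      fix t assume "t \<in> A \<inter> B"
      with Int.IH obtain d e where "d > 0" "{t..<t + d} \<subseteq> A" "e > 0" "{t..<t + e} \<subseteq> B"
        by blast
      moreover have "{t..<t + min d e} \<subseteq> {t..<t + d}" "{t..<t + min d e} \<subseteq> {t..<t + e}"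
        by auto
      ultimately have "0 < min d e \<and> {t..<t + min d e} \<subseteq> A \<inter> B"
        by (metis Int_subset_iff min_less_iff_conj order_trans)
      then show "\<exists>\<delta>>0. {t..<t + \<delta>} \<subseteq> A \<inter> B" ..
    qed
  next
    case (UN K)
    then show ?case by (meson Union_iff Union_upper order_trans)
  next
    case (Basis S)
    then obtain a b where S: "S = {a..<b}" by blast
    show ?case
    proof
      fix t assume "t \<in> S"
      then show "\<exists>\<delta>>0. {t..<t + \<delta>} \<subseteq> S"
        by (intro exI[of _ "b - t"]) (auto simp: S)
    qed
  qed
next
  assume *: "\<forall>t\<in>D. \<exists>\<delta>>0. {t..<t + \<delta>} \<subseteq> D"
  have "\<exists>T. openin sorgenfrey_topology T \<and> t \<in> T \<and> T \<subseteq> D" if "t \<in> D" for t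
  proof -
    from * that obtain d where "d > 0" "{t..<t + d} \<subseteq> D" by blast
    moreover have "openin sorgenfrey_topology {t..<t + d}"
      unfolding sorgenfrey_topology_def by (rule topology_generated_by_Basis) blast
    ultimately show ?thesis by (intro exI[of _ "{t..<t + d}"]) auto
  qed
  then show "openin sorgenfrey_topology D"
    by (subst openin_subopen) blast
qed

text \<open>Nonemptiness is implicit in the mathematical condition \<open>inf D = 0\<close>, but the infimum of the
  empty set of reals is an unspecified value in HOL.\<close>

definition admissible_diameters :: "real set set" where
  "admissible_diameters =
     {D. D \<subseteq> {0<..} \<and> D \<noteq> {} \<and> Inf D = 0 \<and> openin sorgenfrey_topology D}"


section \<open>Restricted Hausdorff dimensions\<close>

text \<open>A set with diameter in \<^term>\<open>D \<subseteq> {0<..}\<close> has finite diameter; boundedness has to be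
  required separately because \<^const>\<open>diameter\<close> takes an unspecified real value on unbounded sets.
  Since all diameters are positive, \<open>powr\<close> agrees with the usual power also for \<open>s = 0\<close>.\<close>

definition restricted_hausdorff_content ::
    "real set \<Rightarrow> real \<Rightarrow> 'a::metric_space set \<Rightarrow> ennreal" where
  "restricted_hausdorff_content D s E =
     Inf {\<Sum>i. ennreal (diameter (C i) powr s) | C :: nat \<Rightarrow> 'a set.
            E \<subseteq> (\<Union>i. C i) \<and> (\<forall>i. bounded (C i) \<and> diameter (C i) \<in> D)}"

definition restricted_hausdorff_dim :: "real set \<Rightarrow> 'a::metric_space set \<Rightarrow> ennreal" where
  "restricted_hausdorff_dim D E =
     Inf {ennreal s | s. 0 \<le> s \<and> restricted_hausdorff_content D s E = 0}"

definition universal_hausdorff_dim :: "'a::metric_space set \<Rightarrow> ennreal" where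
  "universal_hausdorff_dim E = Sup {restricted_hausdorff_dim D E | D. D \<in> admissible_diameters}"

end

theory Submission
  imports Defs
begin

text \<open>
  No set has dimension above \<open>n = DIM('a)\<close>: for \<open>s > n\<close>, a ball of radius \<open>k\<close> is covered by
  \<open>O((k/d)\<^sup>n)\<close> balls of diameter exactly \<open>d\<close>, at the cost \<open>O(k\<^sup>n d\<^sup>s\<^sup>-\<^sup>n)\<close>. Since every admissible \<open>D\<close> has
  arbitrarily small elements \<open>d\<close>, the cost of covering each of these balls can be made as small as
  wanted (\<open>universal_hausdorff_dim_le_DIM\<close>).

  For the lower bound let \<open>E\<close> contain \<open>B \<inter> (\<Inter>k. U k)\<close>, where \<open>B\<close> is a ball and the \<open>U k\<close> are open
  and dense. The set \<open>D\<close> may depend on \<open>E\<close>, and it is built from scales that decrease very quickly: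
  \<open>D = (\<Union>k. {d k..<2 * d k})\<close>, with auxiliary radii \<open>r 0 > d 0 > r 1 > d 1 > \<dots>\<close>. Here \<open>r 0\<close> is the
  radius of \<open>B\<close>. The radius \<open>r (k + 1)\<close> is so small that every ball of radius \<open>d k\<close> centred in \<open>B\<close>
  contains a ball of radius \<open>r (k + 1)\<close> that lies in \<open>U k\<close>; compactness of \<open>B\<close> makes this possible.
  The scale \<open>d k\<close> is so small that \<open>d k powr (-s)\<close> balls with radius of order \<open>d k\<close> cannot fill a ball
  of radius \<open>r k / 2\<close>; as \<open>s < n\<close>, comparing volumes shows that this is possible. Neither choice
  refers to a covering.

  Suppose now that sets with diameters in \<open>D\<close> and \<open>s\<close>-sum at most \<open>1\<close> cover \<open>E\<close>. At most
  \<open>d k powr (-s)\<close> of them have a diameter of order \<open>d k\<close>, so inside any ball of radius \<open>r k\<close> there is a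
  ball of radius \<open>d k\<close> that misses all of these, and inside that one a ball of radius \<open>r (k + 1)\<close> that
  lies in \<open>U k\<close>. The common point of the resulting nested balls belongs to \<open>E\<close> and to no covering set,
  a contradiction. So \<open>dim\<^sub>H\<^sup>D E \<ge> s\<close>, and \<open>s < n\<close> was arbitrary.

  A non-meager set with the Baire property is comeager in some ball, and a \<open>G\<^sub>\<delta>\<close> set that contains a
  dense set is an intersection of dense open sets; in both cases \<open>dim\<^sub>U\<close> is \<open>n\<close>, which is positive.
\<close>

section \<open>Counting balls by volume\<close>

lemma powr_less_near_zero:
  fixes a b :: real
  assumes "0 < a" "0 < b"
  shows "\<exists>\<delta>>0. \<forall>x. 0 < x \<and> x < \<delta> \<longrightarrow> x powr a < b"
proof (intro exI conjI allI impI)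
  show "0 < b powr (1 / a)" using assms by simp
  fix x assume x: "0 < x \<and> x < b powr (1 / a)"
  then have "x powr a < (b powr (1 / a)) powr a"
    using assms by (intro powr_less_mono2) auto
  also have "\<dots> = b" using assms by (simp add: powr_powr)
  finally show "x powr a < b" .
qed

lemma cball_fmeasurable: "cball x r \<in> fmeasurable (lborel :: 'a::euclidean_space measure)"
  using fmeasurable_compact[OF compact_cball] by blast

lemma packing_bound:
  fixes P :: "'a::euclidean_space set"
  assumes fin: "finite P" and r: "0 \<le> r" and R: "0 \<le> R"
    and dis: "pairwise (\<lambda>p q. disjnt (cball p r) (cball q r)) P"
    and sub: "(\<Union>p\<in>P. cball p r) \<subseteq> cball c R"
  shows "real (card P) * r ^ DIM('a) \<le> R ^ DIM('a)"
proof -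
  let ?v = "unit_ball_vol (real DIM('a))"
  have "?v * (real (card P) * r ^ DIM('a)) = (\<Sum>p\<in>P. measure lborel (cball p r))"
    using r by (simp add: content_cball)
  also have "\<dots> = measure lborel (\<Union>p\<in>P. cball p r)"
    by (rule measure_UNION'[symmetric]) (use fin dis cball_fmeasurable in auto)
  also have "\<dots> \<le> measure lborel (cball c R)"
    by (rule measure_mono_fmeasurable) (use sub fin cball_fmeasurable in auto)
  also have "\<dots> = ?v * R ^ DIM('a)" using R by (simp add: content_cball)
  finally show ?thesis by (simp add: mult_le_cancel_left_pos)
qed

lemma covering_bound:
  fixes P :: "'i set" and q :: "'i \<Rightarrow> 'a::euclidean_space"
  assumes fin: "finite P" and r: "0 \<le> r" and R: "0 \<le> R"
    and sub: "cball c R \<subseteq> (\<Union>p\<in>P. cball (q p) r)"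
  shows "R ^ DIM('a) \<le> real (card P) * r ^ DIM('a)"
proof -
  let ?v = "unit_ball_vol (real DIM('a))"
  have "?v * R ^ DIM('a) = measure lborel (cball c R)" using R by (simp add: content_cball)
  also have "\<dots> \<le> measure lborel (\<Union>p\<in>P. cball (q p) r)"
    by (rule measure_mono_fmeasurable) (use sub fin cball_fmeasurable in auto)
  also have "\<dots> \<le> (\<Sum>p\<in>P. measure lborel (cball (q p) r))"
    by (rule measure_UNION_le) (use fin in auto)
  also have "\<dots> = ?v * (real (card P) * r ^ DIM('a))"
    using r by (simp add: content_cball)
  finally show ?thesis by (simp add: mult_le_cancel_left_pos)
qed

text \<open>By Vitali's covering lemma some disjoint balls of radius \<open>d / 10\<close>, centred in the large ball, cover
  it when enlarged five times to diameter \<open>d\<close>. Being disjoint, they are few. The diameters have to be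
  controlled exactly, because an admissible set may contain nothing between much smaller and much
  larger numbers.\<close>

lemma finite_cover_by_balls_of_diameter:
  fixes d R :: real
  assumes "0 \<le> R" "0 < d" "d \<le> 1"
  obtains P :: "'a::euclidean_space set" where "finite P" "P \<noteq> {}"
    "cball 0 R \<subseteq> (\<Union>p\<in>P. cball p (d / 2))"
    "real (card P) * (d / 10) ^ DIM('a) \<le> (R + 1) ^ DIM('a)"
proof -
  obtain C where C: "C \<subseteq> cball (0::'a) R"
     "pairwise (\<lambda>i j. disjnt (cball i (d / 10)) (cball j (d / 10))) C"
     "cball 0 R \<subseteq> (\<Union>i\<in>C. cball i (5 * (d / 10)))"
  proof (rule Vitali_covering_lemma_cballs[where S = "cball (0::'a) R" and K = "cball 0 R"
        and a = "\<lambda>x. x" and r = "\<lambda>_. d / 10" and B = 1])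
    show "cball (0::'a) R \<subseteq> (\<Union>i\<in>cball 0 R. cball i (d / 10))" using assms by force
  qed (use assms that in auto)
  have bound: "real (card G) * (d / 10) ^ DIM('a) \<le> (R + 1) ^ DIM('a)" if "G \<subseteq> C" "finite G" for G
  proof (rule packing_bound[where c = 0])
    show "pairwise (\<lambda>p q. disjnt (cball p (d / 10)) (cball q (d / 10))) G"
      using C(2) that(1) by (rule pairwise_subset)
    show "(\<Union>p\<in>G. cball p (d / 10)) \<subseteq> cball 0 (R + 1)"
    proof clarify
      fix x p assume "p \<in> G" "x \<in> cball p (d / 10)"
      then have "norm p \<le> R" "dist p x \<le> d / 10" using that C(1) by auto
      then show "x \<in> cball 0 (R + 1)"
        using assms norm_triangle_ineq2[of x p] by (simp add: dist_norm norm_minus_commute)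
    qed
  qed (use that assms in auto)
  \<comment> \<open>Vitali only yields countably many balls; the volume bound on finite subfamilies makes them finitely many.\<close>
  have "card G \<le> nat \<lceil>(R + 1) ^ DIM('a) / (d / 10) ^ DIM('a)\<rceil>" if "G \<subseteq> C" "finite G" for G
  proof -
    have "real (card G) \<le> (R + 1) ^ DIM('a) / (d / 10) ^ DIM('a)"
      using bound[OF that] assms by (simp add: pos_le_divide_eq)
    then show ?thesis by linarith
  qed
  then have fin: "finite C" using finite_if_finite_subsets_card_bdd by blast
  have "C \<noteq> {}" using C(3) assms(1) by (auto dest!: subsetD[of _ _ 0])
  then show ?thesis using that[of C] fin bound[of C] C(3) by auto
qed

section \<open>The dimension of the space as upper bound\<close>

lemma restricted_hausdorff_content_mono:
  "E \<subseteq> F \<Longrightarrow> restricted_hausdorff_content D s E \<le> restricted_hausdorff_content D s F"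
  unfolding restricted_hausdorff_content_def by (rule Inf_superset_mono) blast

lemma admissible_diametersD:
  assumes "D \<in> admissible_diameters" "0 < e"
  obtains d where "d \<in> D" "0 < d" "d < e"
proof -
  from assms have D: "D \<subseteq> {0<..}" "D \<noteq> {}" "Inf D = 0" by (auto simp: admissible_diameters_def)
  then have "\<exists>d\<in>D. d < e" using cInf_lessD[of D e] assms(2) by auto
  then show ?thesis using that D(1) by auto
qed

text \<open>The ball of radius \<open>k\<close> is covered at cost at most \<open>\<epsilon> / 2 ^ (k + 1)\<close>, with a diameter \<open>d k \<in> D\<close> that
  depends on \<open>k\<close>. Enumerating all pairs of a radius and a covering ball turns these countably many
  finite coverings into a single sequence. None of them may be empty: infinitely many pairs are needed
  to fill a sequence, since the diameter \<open>0\<close> is not admissible and padding with empty sets is thus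
  impossible.\<close>

lemma restricted_hausdorff_content_UNIV_eq_0:
  assumes D: "D \<in> admissible_diameters" and s: "real DIM('a) < s"
  shows "restricted_hausdorff_content D s (UNIV :: 'a::euclidean_space set) = 0"
proof -
  let ?n = "DIM('a)"
  have le: "restricted_hausdorff_content D s (UNIV :: 'a set) \<le> ennreal \<epsilon>" if \<epsilon>: "0 < \<epsilon>" for \<epsilon>
  proof -
    have "\<exists>d P. d \<in> D \<and> 0 < d \<and> finite P \<and> P \<noteq> {} \<and> cball (0::'a) (real k) \<subseteq> (\<Union>p\<in>P. cball p (d / 2))
            \<and> real (card P) * d powr s \<le> \<epsilon> * (1/2) ^ Suc k" for k
    proof -
      have "\<exists>\<delta>>0. \<forall>x. 0 < x \<and> x < \<delta> \<longrightarrow>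
              x powr (s - ?n) < \<epsilon> * (1/2) ^ Suc k / (10 * (real k + 1)) ^ ?n"
        using s \<epsilon> by (intro powr_less_near_zero) auto
      then obtain \<delta> where \<delta>: "0 < \<delta>" "\<And>x. 0 < x \<Longrightarrow> x < \<delta> \<Longrightarrow>
              x powr (s - ?n) < \<epsilon> * (1/2) ^ Suc k / (10 * (real k + 1)) ^ ?n" by blast
      obtain d where d: "d \<in> D" "0 < d" "d < min \<delta> 1"
        using admissible_diametersD[OF D, of "min \<delta> 1"] \<delta>(1) by auto
      obtain P :: "'a set" where P: "finite P" "P \<noteq> {}" "cball 0 (real k) \<subseteq> (\<Union>p\<in>P. cball p (d / 2))"
        "real (card P) * (d / 10) ^ ?n \<le> (real k + 1) ^ ?n"
        using finite_cover_by_balls_of_diameter[of "real k" d] d by auto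
      have "real (card P) * d powr s = real (card P) * d ^ ?n * d powr (s - ?n)"
        using d by (simp add: powr_diff powr_realpow)
      also have "\<dots> \<le> (10 * (real k + 1)) ^ ?n * d powr (s - ?n)"
      proof (rule mult_right_mono)
        have "real (card P) * d ^ ?n = 10 ^ ?n * (real (card P) * (d / 10) ^ ?n)"
          by (simp add: power_divide)
        also have "\<dots> \<le> 10 ^ ?n * (real k + 1) ^ ?n" using P(4) by (intro mult_left_mono) auto
        finally show "real (card P) * d ^ ?n \<le> (10 * (real k + 1)) ^ ?n"
          by (simp only: power_mult_distrib)
      qed simp
      also have "\<dots> \<le> \<epsilon> * (1/2) ^ Suc k"
        using \<delta>(2)[of d] d by (simp add: field_simps)
      finally show ?thesis using d P by blast
    qed
    then obtain d P where dP: "\<And>k. d k \<in> D" "\<And>k. 0 < d k" "\<And>k. finite (P k)" "\<And>k. P k \<noteq> {}"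
      "\<And>k. cball (0::'a) (real k) \<subseteq> (\<Union>p\<in>P k. cball p (d k / 2))"
      "\<And>k. real (card (P k)) * d k powr s \<le> \<epsilon> * (1/2) ^ Suc k" by metis
    define I where "I = (SIGMA k:UNIV. P k)"
    have "countable I" unfolding I_def using dP(3) by (auto intro: countable_finite)
    moreover have "infinite I"
    proof
      assume "finite I"
      then have "finite (fst ` I)" by simp
      moreover have "fst ` I = UNIV" using dP(4) by (force simp: I_def)
      ultimately show False by simp
    qed
    ultimately have bij: "bij_betw (from_nat_into I) UNIV I" by (rule bij_betw_from_nat_into)
    define g where "g = from_nat_into I"
    have inj: "inj g" and rng: "range g = I" using bij by (auto simp: g_def bij_betw_def)
    define C where "C = (\<lambda>i. cball (snd (g i)) (d (fst (g i)) / 2))"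
    have diam: "diameter (C i) = d (fst (g i))" for i
      using dP(2)[of "fst (g i)"] by (simp add: C_def)
    have cov: "UNIV \<subseteq> (\<Union>i. C i)"
    proof
      fix x :: 'a
      obtain k where "norm x \<le> real k" using real_arch_simple by blast
      then obtain p where p: "p \<in> P k" "x \<in> cball p (d k / 2)" using dP(5)[of k] by auto
      then have "(k, p) \<in> range g" by (simp add: rng I_def)
      then obtain i where "g i = (k, p)" by (metis rangeE)
      then show "x \<in> (\<Union>i. C i)" using p by (auto simp: C_def intro!: exI[of _ i])
    qed
    \<comment> \<open>Bounding finite partial sums suffices, so the rearrangement takes place among finite sums.\<close>
    have partial: "(\<Sum>i<m. diameter (C i) powr s) \<le> \<epsilon>" for m
    proof -
      obtain K where K: "fst ` g ` {..<m} \<subseteq> {..<K}"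
        using finite_nat_iff_bounded[of "fst ` g ` {..<m}"] by auto
      have "(\<Sum>i<m. diameter (C i) powr s) = (\<Sum>t\<in>g ` {..<m}. d (fst t) powr s)"
        using inj by (subst sum.reindex) (auto simp: diam inj_def intro: inj_onI)
      also have "\<dots> \<le> (\<Sum>t\<in>(SIGMA k:{..<K}. P k). d (fst t) powr s)"
      proof (rule sum_mono2)
        show "g ` {..<m} \<subseteq> (SIGMA k:{..<K}. P k)"
        proof
          fix t assume t: "t \<in> g ` {..<m}"
          then have "t \<in> I" using rng by blast
          moreover have "fst t < K" using K t by auto
          ultimately show "t \<in> (SIGMA k:{..<K}. P k)" by (auto simp: I_def)
        qed
      qed (use dP(3) in auto)
      also have "\<dots> = (\<Sum>k<K. real (card (P k)) * d k powr s)"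
        using dP(3) by (subst sum.Sigma[symmetric, where g = "\<lambda>k _. d k powr s", simplified split_def]) auto
      also have "\<dots> \<le> (\<Sum>k<K. \<epsilon> * (1/2) ^ Suc k)" by (intro sum_mono dP(6))
      also have "\<dots> = \<epsilon> * (1 - (1/2) ^ K)"
        by (induction K) (auto simp: field_simps)
      also have "\<dots> \<le> \<epsilon>" using \<epsilon> by (simp add: mult_le_cancel_left1)
      finally show ?thesis .
    qed
    have "(\<Sum>i. ennreal (diameter (C i) powr s)) \<le> ennreal \<epsilon>"
      unfolding suminf_eq_SUP
      by (rule SUP_least) (use partial in \<open>simp add: sum_ennreal ennreal_leI\<close>)
    moreover have "restricted_hausdorff_content D s (UNIV :: 'a set) \<le> (\<Sum>i. ennreal (diameter (C i) powr s))"
      unfolding restricted_hausdorff_content_def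
    proof (intro Inf_lower CollectI exI[of _ C] conjI allI)
      show "bounded (C i)" for i by (simp add: C_def)
    qed (use cov dP(1) in \<open>simp_all add: diam\<close>)
    ultimately show ?thesis by (rule order_trans[rotated])
  qed
  have "restricted_hausdorff_content D s (UNIV :: 'a set) \<le> 0"
    by (rule ennreal_le_epsilon) (use le in simp)
  then show ?thesis by simp
qed

lemma universal_hausdorff_dim_le_DIM:
  fixes E :: "'a::euclidean_space set"
  shows "universal_hausdorff_dim E \<le> of_nat DIM('a)"
  unfolding universal_hausdorff_dim_def
proof (rule Sup_least, clarify)
  fix D assume D: "D \<in> admissible_diameters"
  show "restricted_hausdorff_dim D E \<le> of_nat DIM('a)"
  proof (rule ennreal_le_epsilon)
    fix e :: real assume e: "0 < e"
    have "restricted_hausdorff_content D (real DIM('a) + e) E = 0"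
      using restricted_hausdorff_content_mono[of E UNIV D "real DIM('a) + e"]
        restricted_hausdorff_content_UNIV_eq_0[OF D, of "real DIM('a) + e", where 'a = 'a] e by simp
    then have "restricted_hausdorff_dim D E \<le> ennreal (real DIM('a) + e)"
      unfolding restricted_hausdorff_dim_def 
      by (intro Inf_lower CollectI exI[of _ "real DIM('a) + e"]) (use e in simp)
    then show "restricted_hausdorff_dim D E \<le> of_nat DIM('a) + ennreal e"
      using e by (simp add: ennreal_plus ennreal_of_nat_eq_real_of_nat)
  qed
qed

section \<open>Choosing the scales and the nested balls\<close>

text \<open>If a point of the ball of half the radius is further than \<open>3 * d\<close> from one point of each set, then,
  as the sets have diameter at most \<open>2 * d\<close>, the ball of radius \<open>d\<close> about it meets none of them. Such a
  point exists because the balls of radius \<open>3 * d\<close> about the chosen points are too few to cover.\<close>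

lemma cball_avoiding_small_sets:
  fixes C :: "'i \<Rightarrow> 'a::euclidean_space set"
  assumes fin: "finite I" and d: "0 < d" "d \<le> r / 2"
    and card: "real (card I) * (3 * d) ^ DIM('a) < (r / 2) ^ DIM('a)"
    and small: "\<And>i. i \<in> I \<Longrightarrow> bounded (C i) \<and> diameter (C i) \<le> 2 * d"
  obtains y where "cball y d \<subseteq> cball x r" "cball y d \<inter> (\<Union>i\<in>I. C i) = {}"
proof -
  \<comment> \<open>For an empty set this is an arbitrary point, which merely adds a ball to be avoided.\<close>
  define p where "p i = (SOME z. z \<in> C i)" for i
  have "\<not> cball x (r / 2) \<subseteq> (\<Union>i\<in>I. cball (p i) (3 * d))"
    using covering_bound[OF fin, of "3 * d" "r / 2" x p] d card by linarith
  then obtain y where y: "dist x y \<le> r / 2" "\<And>i. i \<in> I \<Longrightarrow> 3 * d < dist (p i) y" by force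
  show ?thesis
  proof
    show "cball y d \<subseteq> cball x r"
    proof
      fix z assume "z \<in> cball y d"
      then show "z \<in> cball x r" using y(1) d dist_triangle[of x z y] by simp
    qed
    show "cball y d \<inter> (\<Union>i\<in>I. C i) = {}"
    proof (rule ccontr)
      assume "\<not> ?thesis"
      then obtain z i where z: "dist y z \<le> d" "i \<in> I" "z \<in> C i" by auto
      then have "p i \<in> C i" unfolding p_def by (metis someI)
      then have "dist (p i) z \<le> 2 * d"
        using small[OF z(2)] z(3) diameter_bounded_bound by (metis order_trans)
      then show False using y(2)[OF z(2)] z(1) dist_triangle[of "p i" y z] by (simp add: dist_commute)
    qed
  qed
qed

text \<open>The point of the lemma is that \<open>\<rho>\<close> does not depend on \<open>y\<close>. Where the nested balls lie depends on the
  covering, whereas their radii must be fixed before any covering is given.\<close>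

lemma uniform_radius_in_dense_open:
  fixes U :: "'a::euclidean_space set"
  assumes U: "open U" "closure U = UNIV" and d: "0 < d" and K: "compact K"
  shows "\<exists>\<rho>>0. \<forall>y\<in>K. \<exists>z. cball z \<rho> \<subseteq> ball y d \<inter> U"
proof -
  have "\<exists>z e. 0 < e \<and> cball z e \<subseteq> ball p (d / 2) \<inter> U" for p
  proof -
    have "ball p (d / 2) \<inter> U \<noteq> {}"
      using open_Int_closure_eq_empty[of "ball p (d / 2)" U] U(2) d by auto
    then obtain z where "z \<in> ball p (d / 2) \<inter> U" by blast
    moreover have "open (ball p (d / 2) \<inter> U)" using U(1) by blast
    ultimately show ?thesis using open_contains_cball by blast
  qed
  then obtain z e where ze: "\<And>p. 0 < e p" "\<And>p. cball (z p) (e p) \<subseteq> ball p (d / 2) \<inter> U" by metis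
  have "K \<subseteq> (\<Union>p\<in>K. ball p (d / 2))" using d by force
  then obtain F where F: "F \<subseteq> K" "finite F" "K \<subseteq> (\<Union>p\<in>F. ball p (d / 2))"
    using compactE_image[OF K, of K "\<lambda>p. ball p (d / 2)"] by (metis open_ball)
  define \<rho> where "\<rho> = Min (insert 1 (e ` F))"
  have "0 < \<rho>" unfolding \<rho>_def using F(2) ze(1) by (subst Min_gr_iff) auto
  moreover have "\<exists>w. cball w \<rho> \<subseteq> ball y d \<inter> U" if "y \<in> K" for y
  proof -
    obtain p where p: "p \<in> F" "dist p y < d / 2" using subsetD[OF F(3) \<open>y \<in> K\<close>] by auto
    have "\<rho> \<le> e p" unfolding \<rho>_def using F(2) p(1) by (intro Min_le) auto
    then have "cball (z p) \<rho> \<subseteq> ball p (d / 2) \<inter> U" using ze(2)[of p] by (meson subset_cball order_trans)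
    moreover have "ball p (d / 2) \<subseteq> ball y d"
    proof
      fix x assume "x \<in> ball p (d / 2)"
      then show "x \<in> ball y d" using p(2) dist_triangle[of y x p] by (simp add: dist_commute)
    qed
    ultimately show ?thesis by blast
  qed
  ultimately show ?thesis by blast
qed

lemma scales_admissible:
  fixes d :: "nat \<Rightarrow> real"
  assumes d: "\<And>k. 0 < d k" "\<And>k. d k \<le> 1 / (real k + 1)"
  shows "(\<Union>k. {d k..<2 * d k}) \<in> admissible_diameters"
proof -
  let ?D = "\<Union>k. {d k..<2 * d k}"
  have mem: "d k \<in> ?D" for k using d(1)[of k] by force
  have pos: "0 < t" if "t \<in> ?D" for t using that d(1) by (force intro: less_le_trans)
  have "Inf ?D \<le> 0 + e" if "0 < e" for e
  proof -
    obtain k where k: "inverse (real (Suc k)) < e" using reals_Archimedean \<open>0 < e\<close> by blast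
    have "Inf ?D \<le> d k"
      by (rule cInf_lower[OF mem]) (use pos in \<open>meson bdd_belowI less_imp_le\<close>)
    then show ?thesis using d(2)[of k] k by (simp add: inverse_eq_divide add.commute)
  qed
  then have "Inf ?D \<le> 0" by (rule field_le_epsilon)
  moreover have "0 \<le> Inf ?D"
    using mem pos by (intro cInf_greatest) (blast, meson less_imp_le)
  moreover have "\<exists>\<delta>>0. {t..<t + \<delta>} \<subseteq> ?D" if t: "t \<in> ?D" for t
  proof -
    obtain k where k: "d k \<le> t" "t < 2 * d k" using t by auto
    then have "{t..<t + (2 * d k - t)} \<subseteq> {d k..<2 * d k}" by auto
    then have "{t..<t + (2 * d k - t)} \<subseteq> ?D" by blast
    then show ?thesis using k(2) by (intro exI[of _ "2 * d k - t"]) simp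
  qed
  then have "openin sorgenfrey_topology ?D" unfolding openin_sorgenfrey_topology_iff by blast
  moreover have "?D \<subseteq> {0<..}" using pos by blast
  moreover have "?D \<noteq> {}" using mem by blast
  ultimately show ?thesis unfolding admissible_diameters_def by simp
qed

text \<open>The nested-ball argument for scales \<open>d k\<close> and radii \<open>r k\<close> that are already given. It refutes
  coverings with \<open>t\<close>-sum at most \<open>1\<close> for all \<open>t \<le> s\<close> at once, not only for \<open>t = s\<close>, since the dimension is
  an infimum over all exponents of zero content. This costs nothing, because \<open>d k < 1\<close> gives
  \<open>d k powr (- t) \<le> d k powr (- s)\<close>.\<close>

lemma restricted_dim_ge_of_scales:
  fixes U :: "nat \<Rightarrow> 'a::euclidean_space set" and d r :: "nat \<Rightarrow> real"
  assumes E: "cball c (r 0) \<inter> (\<Inter>k. U k) \<subseteq> E"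
    and r: "\<And>k. 0 < r k"
    and d: "\<And>k. 0 < d k" "\<And>k. d k < 1" "\<And>k. d k \<le> r k / 2"
    and few: "\<And>k. d k powr (- s) * (3 * d k) ^ DIM('a) < (r k / 2) ^ DIM('a)"
    and U: "\<And>k y. y \<in> cball c (r 0) \<Longrightarrow> \<exists>z. cball z (r (Suc k)) \<subseteq> ball y (d k) \<inter> U k"
  shows "ennreal s \<le> restricted_hausdorff_dim (\<Union>k. {d k..<2 * d k}) E"
proof -
  let ?D = "\<Union>k. {d k..<2 * d k}"
  have large: "1 < (\<Sum>i. ennreal (diameter (C i) powr t))"
    if cov: "E \<subseteq> (\<Union>i. C i)" and C: "\<And>i. bounded (C i)" "\<And>i. diameter (C i) \<in> ?D"
      and t: "0 \<le> t" "t \<le> s" for t and C :: "nat \<Rightarrow> 'a set"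
  proof (rule ccontr)
    assume "\<not> ?thesis"
    then have le1: "(\<Sum>i. ennreal (diameter (C i) powr t)) \<le> 1" by simp
    define I where "I k = {i. diameter (C i) \<in> {d k..<2 * d k}}" for k
    have card_bound: "real (card G) \<le> d k powr (- s)" if G: "G \<subseteq> I k" "finite G" for G k
    proof -
      have "ennreal (\<Sum>i\<in>G. diameter (C i) powr t) = (\<Sum>i\<in>G. ennreal (diameter (C i) powr t))"
        by (simp add: sum_ennreal)
      also have "\<dots> \<le> (\<Sum>i. ennreal (diameter (C i) powr t))"
        by (rule sum_le_suminf) (use G in auto)
      finally have "ennreal (\<Sum>i\<in>G. diameter (C i) powr t) \<le> 1" using le1 by (rule order_trans)
      then have sum1: "(\<Sum>i\<in>G. diameter (C i) powr t) \<le> 1" by simp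
      have "real (card G) * d k powr t = (\<Sum>i\<in>G. d k powr t)" by simp
      also have "\<dots> \<le> (\<Sum>i\<in>G. diameter (C i) powr t)"
        by (rule sum_mono, rule powr_mono2) (use G d(1)[of k] t in \<open>auto simp: I_def\<close>)
      finally have "real (card G) * d k powr t \<le> 1" using sum1 by simp
      then have "real (card G) \<le> d k powr (- t)"
        using d(1)[of k] by (simp add: powr_minus_divide pos_le_divide_eq)
      also have "\<dots> \<le> d k powr (- s)"
        using d(1,2)[of k] t by (intro powr_mono') auto
      finally show ?thesis .
    qed
    have finI: "finite (I k)" for k
    proof -
      have "card G \<le> nat \<lceil>d k powr (- s)\<rceil>" if "G \<subseteq> I k" "finite G" for G
        using card_bound[OF that] by linarith
      then show ?thesis using finite_if_finite_subsets_card_bdd by blast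
    qed
    have step: "\<exists>z. cball z (r (Suc k)) \<subseteq> cball x (r k) \<inter> U k - (\<Union>i\<in>I k. C i)"
      if x: "cball x (r k) \<subseteq> cball c (r 0)" for x k
    proof -
      have "real (card (I k)) * (3 * d k) ^ DIM('a) \<le> d k powr (- s) * (3 * d k) ^ DIM('a)"
        using card_bound[of "I k"] finI d(1)[of k] by (intro mult_right_mono) auto
      also note few[of k]
      finally have few_sets: "real (card (I k)) * (3 * d k) ^ DIM('a) < (r k / 2) ^ DIM('a)" .
      have "bounded (C i) \<and> diameter (C i) \<le> 2 * d k" if "i \<in> I k" for i
        using that C(1) by (simp add: I_def)
      then obtain y where y: "cball y (d k) \<subseteq> cball x (r k)" "cball y (d k) \<inter> (\<Union>i\<in>I k. C i) = {}"
        using cball_avoiding_small_sets[OF finI d(1) d(3) few_sets] by blast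
      have "y \<in> cball c (r 0)" using y(1) x d(1)[of k] by (meson centre_in_cball less_imp_le subsetD)
      then obtain z where "cball z (r (Suc k)) \<subseteq> ball y (d k) \<inter> U k" using U by blast
      then show ?thesis using y ball_subset_cball[of y "d k"] by blast
    qed
    have "\<exists>x. \<forall>k. cball (x k) (r k) \<subseteq> cball c (r 0) \<and>
            cball (x (Suc k)) (r (Suc k)) \<subseteq> cball (x k) (r k) \<inter> U k - (\<Union>i\<in>I k. C i)"
    proof (rule dependent_nat_choice)
      show "\<exists>x. cball x (r 0) \<subseteq> cball c (r 0)" by blast
      fix x k assume "cball x (r k) \<subseteq> cball c (r 0)"
      then show "\<exists>z. cball z (r (Suc k)) \<subseteq> cball c (r 0) \<and>
              cball z (r (Suc k)) \<subseteq> cball x (r k) \<inter> U k - (\<Union>i\<in>I k. C i)"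
        using step[of x k] by blast
    qed
    then obtain x where x: "\<And>k. cball (x k) (r k) \<subseteq> cball c (r 0)"
      "\<And>k. cball (x (Suc k)) (r (Suc k)) \<subseteq> cball (x k) (r k) \<inter> U k - (\<Union>i\<in>I k. C i)" by blast
    have dec: "decseq (\<lambda>k. cball (x k) (r k))" by (rule decseq_SucI) (use x(2) in blast)
    obtain a where a: "\<And>k. a \<in> cball (x k) (r k)"
      by (rule bounded_closed_nest[of "\<lambda>k. cball (x k) (r k)"])
         (use less_imp_le[OF r] dec in \<open>auto simp: decseq_def not_less\<close>)
    have "a \<in> U k" for k using a[of "Suc k"] x(2)[of k] by blast
    moreover have "a \<in> cball c (r 0)" using a[of 0] x(1)[of 0] by blast
    ultimately have "a \<in> E" using E by blast
    then obtain i where i: "a \<in> C i" using cov by blast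
    obtain k where "i \<in> I k" using C(2)[of i] by (auto simp: I_def)
    then show False using i a[of "Suc k"] x(2)[of k] by blast
  qed
  have nonzero: "restricted_hausdorff_content ?D t E \<noteq> 0" if "0 \<le> t" "t \<le> s" for t
  proof -
    have "1 \<le> restricted_hausdorff_content ?D t E"
      unfolding restricted_hausdorff_content_def
      by (rule Inf_greatest) (use large that in \<open>force intro: less_imp_le\<close>)
    then show ?thesis by auto
  qed
  show ?thesis
    unfolding restricted_hausdorff_dim_def
    by (rule Inf_greatest) (use nonzero in \<open>force intro!: ennreal_leI\<close>)
qed

text \<open>The recursion alternates between the two ways of shrinking: \<open>d k\<close> is chosen small relative to \<open>r k\<close>
  by comparing volumes, where \<open>\<delta> powr (- s) * \<delta> ^ n = \<delta> powr (n - s)\<close> tends to \<open>0\<close> with \<open>\<delta>\<close>, and \<open>r (Suc k)\<close> is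
  chosen from \<open>d k\<close> and \<open>U k\<close> by compactness.\<close>

lemma exists_admissible_restricted_dim_ge:
  fixes U :: "nat \<Rightarrow> 'a::euclidean_space set"
  assumes U: "\<And>k. open (U k)" "\<And>k. closure (U k) = UNIV"
    and R: "0 < R" and E: "cball c R \<inter> (\<Inter>k. U k) \<subseteq> E" and s: "s < real DIM('a)"
  shows "\<exists>D\<in>admissible_diameters. ennreal s \<le> restricted_hausdorff_dim D E"
proof -
  let ?n = "DIM('a)"
  let ?small = "\<lambda>k \<rho> \<delta>. 0 < \<delta> \<and> \<delta> < 1 \<and> \<delta> \<le> 1 / (real k + 1) \<and> \<delta> \<le> \<rho> / 2 \<and>
     \<delta> powr (- s) * (3 * \<delta>) ^ ?n < (\<rho> / 2) ^ ?n"
  let ?fits = "\<lambda>k \<delta> \<rho>. \<forall>y\<in>cball c R. \<exists>z. cball z \<rho> \<subseteq> ball y \<delta> \<inter> U k"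
  have small: "\<exists>\<delta>. ?small k \<rho> \<delta>" if \<rho>: "0 < \<rho>" for \<rho> and k :: nat
  proof -
    have "\<exists>\<delta>>0. \<forall>x. 0 < x \<and> x < \<delta> \<longrightarrow> x powr (?n - s) < (\<rho> / 2) ^ ?n / 3 ^ ?n"
      using s \<rho> by (intro powr_less_near_zero) auto
    then obtain \<eta> where \<eta>: "0 < \<eta>" "\<And>x. 0 < x \<Longrightarrow> x < \<eta> \<Longrightarrow> x powr (?n - s) < (\<rho> / 2) ^ ?n / 3 ^ ?n"
      by blast
    define \<delta> where "\<delta> = min (\<eta> / 2) (min (1 / 2) (min (1 / (real k + 1)) (\<rho> / 2)))"
    have \<delta>: "0 < \<delta>" "\<delta> < \<eta>" "\<delta> < 1" "\<delta> \<le> 1 / (real k + 1)" "\<delta> \<le> \<rho> / 2"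
      unfolding \<delta>_def using \<eta>(1) \<rho> by (simp_all add: min_less_iff_disj min_le_iff_disj)
    have "\<delta> powr (- s) * (3 * \<delta>) ^ ?n = 3 ^ ?n * \<delta> powr (?n - s)"
      using \<delta>(1) by (simp add: powr_diff powr_minus_divide powr_realpow power_mult_distrib)
    also have "\<dots> < (\<rho> / 2) ^ ?n"
      using \<eta>(2)[OF \<delta>(1,2)] by (simp add: pos_less_divide_eq mult.commute)
    finally show ?thesis using \<delta> by blast
  qed
  have "\<exists>r. \<forall>k. (0 < r k \<and> (k = 0 \<longrightarrow> r k = R)) \<and> (\<exists>\<delta>. ?small k (r k) \<delta> \<and> ?fits k \<delta> (r (Suc k)))"
  proof (rule dependent_nat_choice)
    show "\<exists>\<rho>. 0 < \<rho> \<and> ((0::nat) = 0 \<longrightarrow> \<rho> = R)" using R by blast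
    fix \<rho> :: real and k :: nat assume "0 < \<rho> \<and> (k = 0 \<longrightarrow> \<rho> = R)"
    then obtain \<delta> where \<delta>: "?small k \<rho> \<delta>" using small by blast
    then obtain \<rho>' where "0 < \<rho>'" "?fits k \<delta> \<rho>'"
      using uniform_radius_in_dense_open[OF U(1)[of k] U(2)[of k] _ compact_cball, of \<delta> c R] by blast
    then show "\<exists>\<rho>'. (0 < \<rho>' \<and> (Suc k = 0 \<longrightarrow> \<rho>' = R)) \<and> (\<exists>\<delta>. ?small k \<rho> \<delta> \<and> ?fits k \<delta> \<rho>')"
      using \<delta> by blast
  qed
  then obtain r where r: "\<And>k. 0 < r k" "r 0 = R" "\<And>k. \<exists>\<delta>. ?small k (r k) \<delta> \<and> ?fits k \<delta> (r (Suc k))"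
    by blast
  then obtain d where d: "\<And>k. ?small k (r k) (d k)" "\<And>k. ?fits k (d k) (r (Suc k))" by metis
  have "(\<Union>k. {d k..<2 * d k}) \<in> admissible_diameters"
    by (rule scales_admissible) (use d(1) in auto)
  moreover have "ennreal s \<le> restricted_hausdorff_dim (\<Union>k. {d k..<2 * d k}) E"
    by (rule restricted_dim_ge_of_scales[where r = r and U = U and c = c])
       (use d r E in auto)
  ultimately show ?thesis by blast
qed

lemma universal_hausdorff_dim_eq_DIM:
  fixes U :: "nat \<Rightarrow> 'a::euclidean_space set"
  assumes U: "\<And>k. open (U k)" "\<And>k. closure (U k) = UNIV"
    and R: "0 < R" and E: "cball c R \<inter> (\<Inter>k. U k) \<subseteq> E"
  shows "universal_hausdorff_dim E = of_nat DIM('a)"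
proof (rule antisym[OF universal_hausdorff_dim_le_DIM])
  show "of_nat DIM('a) \<le> universal_hausdorff_dim E"
  proof (rule ennreal_le_epsilon)
    fix e :: real assume e: "0 < e"
    obtain D where D: "D \<in> admissible_diameters" "ennreal (real DIM('a) - e) \<le> restricted_hausdorff_dim D E"
      using exists_admissible_restricted_dim_ge[OF U R E, of "real DIM('a) - e"] e by auto
    have "of_nat DIM('a) = ennreal ((real DIM('a) - e) + e)"
      by (simp add: ennreal_of_nat_eq_real_of_nat)
    also have "\<dots> \<le> ennreal (real DIM('a) - e) + ennreal e"
      using e by (cases "0 \<le> real DIM('a) - e") (auto simp: ennreal_plus[symmetric] ennreal_neg intro: ennreal_leI simp del: ennreal_plus)
    also have "ennreal (real DIM('a) - e) \<le> universal_hausdorff_dim E"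
      unfolding universal_hausdorff_dim_def
      by (rule order_trans[OF D(2)], rule Sup_upper) (use D(1) in blast)
    finally show "of_nat DIM('a) \<le> universal_hausdorff_dim E + ennreal e" by (simp add: add_right_mono)
  qed
qed

section \<open>Comeager subsets of balls\<close>

lemma meager_subset:
  assumes "meager A" "B \<subseteq> A"
  shows "meager B"
proof -
  obtain N :: "nat \<Rightarrow> 'a set" where N: "\<And>i. nowhere_dense (N i)" "A = (\<Union>i. N i)"
    using assms(1) by (auto simp: meager_def)
  have "nowhere_dense (N i \<inter> B)" for i
    using N(1)[of i] interior_mono[OF closure_mono[of "N i \<inter> B" "N i"]] by (auto simp: nowhere_dense_def)
  moreover have "B = (\<Union>i. N i \<inter> B)" using N(2) assms(2) by auto
  ultimately show ?thesis unfolding meager_def by (intro exI[of _ "\<lambda>i. N i \<inter> B"]) auto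
qed

text \<open>\<open>E\<close> differs by a meager set from an open set \<open>V\<close>, which is nonempty since \<open>E\<close> itself is not meager. In
  a ball inside \<open>V\<close>, avoiding the closures of the nowhere dense sets that make up \<open>V - E\<close> forces
  membership in \<open>E\<close>.\<close>

lemma nonmeager_baire_comeager_in_ball:
  fixes E :: "'a::metric_space set"
  assumes "\<not> meager E" "baire_property E"
  obtains U :: "nat \<Rightarrow> 'a set" and c R where "\<And>k. open (U k)" "\<And>k. closure (U k) = UNIV"
    "0 < R" "cball c R \<inter> (\<Inter>k. U k) \<subseteq> E"
proof -
  obtain V where V: "open V" "meager ((E - V) \<union> (V - E))"
    using assms(2) by (auto simp: baire_property_def)
  have "V \<noteq> {}" using V(2) assms(1) by auto
  then obtain c R where cR: "0 < R" "cball c R \<subseteq> V" using V(1) open_contains_cball by blast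
  obtain N :: "nat \<Rightarrow> 'a set" where N: "\<And>i. nowhere_dense (N i)" "V - E = (\<Union>i. N i)"
    using meager_subset[OF V(2), of "V - E"] by (auto simp: meager_def)
  show ?thesis
  proof (rule that[of "\<lambda>k. - closure (N k)" R c])
    show "closure (- closure (N k)) = UNIV" for k
      using N(1)[of k] by (simp add: nowhere_dense_def closure_complement)
    show "cball c R \<inter> (\<Inter>k. - closure (N k)) \<subseteq> E"
    proof
      fix x assume x: "x \<in> cball c R \<inter> (\<Inter>k. - closure (N k))"
      then have "x \<notin> (\<Union>k. N k)" using closure_subset by fastforce
      then show "x \<in> E" using x cR(2) N(2) by blast
    qed
  qed (use cR in auto)
qed

theorem corollary4p10:
  shows "(\<forall>E :: (real ^ 'n) set. \<not> meager E \<and> baire_property E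
            \<longrightarrow> universal_hausdorff_dim E = of_nat CARD('n)) \<and>
         (\<forall>A :: (real ^ 'n) set. closure A = UNIV
            \<longrightarrow> \<not> (\<exists>G. gdelta G \<and> universal_hausdorff_dim G = 0 \<and> A \<subseteq> G))"
proof (intro conjI allI impI notI)
  fix E :: "(real ^ 'n) set" assume "\<not> meager E \<and> baire_property E"
  then obtain U c R where "\<And>k::nat. open (U k)" "\<And>k. closure (U k) = UNIV"
    "0 < R" "cball c R \<inter> (\<Inter>k. U k) \<subseteq> E"
    using nonmeager_baire_comeager_in_ball by metis
  then show "universal_hausdorff_dim E = of_nat CARD('n)"
    using universal_hausdorff_dim_eq_DIM[of U R c E] by simp
next
  fix A :: "(real ^ 'n) set"
  assume A: "closure A = UNIV" and "\<exists>G. gdelta G \<and> universal_hausdorff_dim G = 0 \<and> A \<subseteq> G"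
  then obtain G where G: "gdelta G" "universal_hausdorff_dim G = 0" "A \<subseteq> G" by blast
  from G(1) obtain U :: "nat \<Rightarrow> (real ^ 'n) set" where U: "\<And>k. open (U k)" "G = (\<Inter>k. U k)"
    by (auto elim: gdelta.cases)
  have "closure (U k) = UNIV" for k
    using closure_mono[of A "U k"] A G(3) U(2) by blast
  then have "universal_hausdorff_dim G = of_nat DIM(real ^ 'n)"
    using universal_hausdorff_dim_eq_DIM[of U 1 0 G] U by auto
  then show False using G(2) by simp
qed

end
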